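(* Let $(X,\Sigma,\mu)$ be a $\sigma$-finite measure space, let $1\le p\le\infty$ and $1\le q\le\infty$ with $\frac1p+\frac1q=1$. Let $l_{A,1},l_{A,2},l_{A,3},l_{B,1},l_{B,2},l_{B,3}$ be positive integers, let $G_A,G_B\in\Sigma$, and for $1\le k\le l_{A,1}$, $1\le i\le l_{A,2}$, $1\le l\le l_{A,3}$, $1\le u\le l_{B,1}$, $1\le w\le l_{B,2}$, $1\le r\le l_{B,3}$ let $a_{k,l},b_{u,r}\in L_p(X,\mu)$, $c_{i,l}\in L_q(G_A,\mu)$, $e_{w,r}\in L_q(G_B,\mu)$ and $\gamma_A^{k,i,l},\gamma_B^{u,w,r}\in\mathbb{R}$. Let $A,B:L_p(X,\mu)\to L_p(X,\mu)$ be nonzero operators defined by $$(Ax)(t)=\int_{G_A}\sum_{k=1}^{l_{A,1}}\sum_{i=1}^{l_{A,2}}\sum_{l=1}^{l_{A,3}}\gamma_A^{k,i,l}a_{k,l}(t)c_{i,l}(s)x(s)\,d\mu_s,$$ $$(Bx)(t)=\int_{G_B}\sum_{u=1}^{l_{B,1}}\sum_{w=1}^{l_{B,2}}\sum_{r=1}^{l_{B,3}}\gamma_B^{u,w,r}b_{u,r}(t)e_{w,r}(s)x(s)\,d\mu_s$$ for almost every $t$. Let $F(z)=\sum_{j=0}^{n}\delta_jz^j$ with $\delta_j\in\mathbb{R}$, $j=0,\dots,n$, and let $G=G_A\cap G_B$. For index triples $(k_1,i_1,l_1),(k_2,i_2,l_2),\dots$ put $$\tilde\gamma_1=1,\qquad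 \tilde\gamma_m=\prod_{v=1}^{m-1}Q_{G_A}(a_{k_{v+1},l_{v+1}},c_{i_v,l_v}),\quad m\ge2$$ (so $\tilde\gamma_m$ depends on the first $m$ triples). Then $AB=BF(A)$ if and only if the following three conditions hold: 1. for almost every $(t,s)\in X\times G$, $$-\sum_{(u,w,r)}\delta_0\gamma_B^{u,w,r}b_{u,r}(t)e_{w,r}(s)+\sum_{(k,i,l)}\sum_{(u,w,r)}\gamma_A^{k,i,l}\gamma_B^{u,w,r}a_{k,l}(t)Q_{G_A}(c_{i,l},b_{u,r})e_{w,r}(s)$$ $$=\sum_{(u,w,r)}\sum_{j=1}^n\sum_{(k_1,i_1,l_1)}\cdots\sum_{(k_j,i_j,l_j)}\delta_j\tilde\gamma_j\gamma_B^{u,w,r}\Big(\prod_{v=1}^{j}\gamma_A^{k_v,i_v,l_v}\Big)Q_{G_B}(e_{w,r},a_{k_1,l_1})b_{u,r}(t)c_{i_j,l_j}(s);$$ 2. for almost every $(t,s)\in X\times(G_A\setminus G)$, $$\sum_{(u,w,r)}\sum_{j=1}^n\sum_{(k_1,i_1,l_1)}\cdots\sum_{(k_j,i_j,l_j)}\delta_j\tilde\gamma_j\gamma_B^{u,w,r}\Big(\prod_{v=1}^{j}\gamma_A^{k_v,i_v,l_v}\Big)Q_{G_B}(e_{w,r},a_{k_1,l_1})b_{u,r}(t)c_{i_j,l_j}(s)=0;$$ 3. for almost every $(t,s)\in X\times(G_B\setminus G)$, $$\sum_{(u,w,r)}\delta_0\gamma_B^{u,w,r}b_{u,r}(t)e_{w,r}(s)=\sum_{(k,i,l)}\sum_{(u,w,r)}\gamma_A^{k,i,l}\gamma_B^{u,w,r}a_{k,l}(t)Q_{G_A}(c_{i,l},b_{u,r})e_{w,r}(s).$$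 Here sums over $(u,w,r)$ run over $1\le u\le l_{B,1}$, $1\le w\le l_{B,2}$, $1\le r\le l_{B,3}$, and sums over $(k,i,l)$ and over each $(k_v,i_v,l_v)$ run over $1\le k\le l_{A,1}$, $1\le i\le l_{A,2}$, $1\le l\le l_{A,3}$.
   Context: $L_p(X,\mu)$ is the Banach space of (classes modulo null sets of) real-valued measurable functions on $X$ with $\int_X|f|^p\,d\mu<\infty$ ($1\le p<\infty$), or essentially bounded ($p=\infty$). For $G\in\Sigma$, $L_q(G,\mu)$ is the same with $X$ replaced by $G$. The relation $\frac1p+\frac1q=1$ uses $1/\infty=0$. The index in $\mu_s$ indicates the variable of integration. For $\Lambda\in\Sigma$ and functions $u,v$ on $\Lambda$ for which the integral exists and is finite, $Q_\Lambda(u,v)=\int_\Lambda u(t)v(t)\,d\mu$. For the polynomial $F$, $F(A)=\delta_0 I+\sum_{j=1}^n\delta_jA^j$. *)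

theory Defs
  imports "HOL-Analysis.Analysis"
begin

definition Lp_fun :: "ennreal \<Rightarrow> 'a measure \<Rightarrow> ('a \<Rightarrow> real) set" where
  "Lp_fun p M = {f \<in> borel_measurable M.
     if p = \<infinity> then \<exists>C. AE x in M. \<bar>f x\<bar> \<le> C
     else integrable M (\<lambda>x. \<bar>f x\<bar> powr enn2real p)}"

definition Lp_rel :: "ennreal \<Rightarrow> 'a measure \<Rightarrow> (('a \<Rightarrow> real) \<times> ('a \<Rightarrow> real)) set" where
  "Lp_rel p M = {(f, g). f \<in> Lp_fun p M \<and> g \<in> Lp_fun p M \<and> (AE x in M. f x = g x)}"

text \<open>Elements of \<open>Lp_space p M\<close> are classes of functions modulo null sets; the linear
  structure is lifted to classes below. Values of functions outside \<open>space M\<close> are irrelevant.\<close>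

definition Lp_space :: "ennreal \<Rightarrow> 'a measure \<Rightarrow> ('a \<Rightarrow> real) set set" where
  "Lp_space p M = Lp_fun p M // Lp_rel p M"

definition Lp_zero :: "ennreal \<Rightarrow> 'a measure \<Rightarrow> ('a \<Rightarrow> real) set" where
  "Lp_zero p M = Lp_rel p M `` {\<lambda>x. 0}"

definition Lp_add ::
  "ennreal \<Rightarrow> 'a measure \<Rightarrow> ('a \<Rightarrow> real) set \<Rightarrow> ('a \<Rightarrow> real) set \<Rightarrow> ('a \<Rightarrow> real) set" where
  "Lp_add p M U V = (\<Union>f\<in>U. \<Union>g\<in>V. Lp_rel p M `` {\<lambda>x. f x + g x})"

definition Lp_scale ::
  "ennreal \<Rightarrow> 'a measure \<Rightarrow> real \<Rightarrow> ('a \<Rightarrow> real) set \<Rightarrow> ('a \<Rightarrow> real) set" where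
  "Lp_scale p M r U = (\<Union>f\<in>U. Lp_rel p M `` {\<lambda>x. r * f x})"

text \<open>\<open>poly_op p M \<delta> A n\<close> is the operator \<open>F(A) = \<delta> 0 I + (\<Sum>j=1..n. \<delta> j A^j)\<close>
  for the polynomial \<open>F(z) = (\<Sum>j=0..n. \<delta> j z^j)\<close>.\<close>

primrec poly_op ::
  "ennreal \<Rightarrow> 'a measure \<Rightarrow> (nat \<Rightarrow> real) \<Rightarrow> (('a \<Rightarrow> real) set \<Rightarrow> ('a \<Rightarrow> real) set)
    \<Rightarrow> nat \<Rightarrow> ('a \<Rightarrow> real) set \<Rightarrow> ('a \<Rightarrow> real) set" where
  "poly_op p M \<delta> A 0 U = Lp_scale p M (\<delta> 0) U"
| "poly_op p M \<delta> A (Suc n) U =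
     Lp_add p M (poly_op p M \<delta> A n U) (Lp_scale p M (\<delta> (Suc n)) ((A ^^ Suc n) U))"

definition Q :: "'a measure \<Rightarrow> 'a set \<Rightarrow> ('a \<Rightarrow> real) \<Rightarrow> ('a \<Rightarrow> real) \<Rightarrow> real" where
  "Q M \<Lambda> u v = (LINT t:\<Lambda>|M. u t * v t)"

text \<open>The index triples are \<open>(k v, i v, l v)\<close> for \<open>v = 1, 2, \<dots>\<close>; only those with
  \<open>1 \<le> v \<le> m\<close> matter.\<close>

definition gamma_tilde ::
  "'a measure \<Rightarrow> 'a set \<Rightarrow> (nat \<Rightarrow> nat \<Rightarrow> 'a \<Rightarrow> real) \<Rightarrow> (nat \<Rightarrow> nat \<Rightarrow> 'a \<Rightarrow> real)
    \<Rightarrow> (nat \<Rightarrow> nat) \<Rightarrow> (nat \<Rightarrow> nat) \<Rightarrow> (nat \<Rightarrow> nat) \<Rightarrow> nat \<Rightarrow> real" where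
  "gamma_tilde M G a c k i l m =
     (\<Prod>v=1..<m. Q M G (a (k (v + 1)) (l (v + 1))) (c (i v) (l v)))"

end

theory Submission
  imports Defs
begin

text \<open>
  Both sides of \<open>AB = BF(A)\<close> are integral operators of finite rank, and their kernels can be
  written down. Applying \<open>A\<close> after \<open>B\<close> contracts every \<open>c\<close> against every \<open>b\<close>, and
  \<open>A^j\<close> has as kernel a sum over chains of \<open>j\<close> index triples, whose weight collects the numbers
  \<open>Q(a, c)\<close> at the \<open>j - 1\<close> joints of the chain (\<open>pow_apply_AE\<close>); applying \<open>B\<close> contracts
  every \<open>e\<close> against the first \<open>a\<close> of the chain. Hence \<open>AB - BF(A)\<close> is the integral operator with kernel
  \<open>1_{GB}(s) K_B(t, s) - 1_{GA}(s) K_A(t, s)\<close>.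
  Here \<open>K_B\<close> comes from \<open>AB - \<delta> 0 B\<close>, which reads its argument only on \<open>GB\<close> through the
  functions \<open>e\<close>, and \<open>K_A\<close> comes from the terms \<open>\<delta> j * B A^j\<close> with \<open>j \<ge> 1\<close>, which read
  their argument only on \<open>GA\<close> through the functions \<open>c\<close>. The equation
  \<open>1_{GB} K_B = 1_{GA} K_A\<close> says \<open>K_B = K_A\<close> on \<open>GA \<inter> GB\<close>, \<open>K_A = 0\<close> on the rest
  of \<open>GA\<close> and \<open>K_B = 0\<close> on the rest of \<open>GB\<close>, which are the three conditions.

  It remains to see that an operator with separable kernel \<open>K(t, s) = \<Sum>i. f i t * g i s\<close>, with
  \<open>f i\<close> measurable and \<open>g i\<close> in \<open>L_q\<close>, is zero on \<open>L_p\<close> only if \<open>K = 0\<close> almost everywhere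
  (\<open>separable_kernel_zero_iff\<close>). The exceptional null set of \<open>t\<close> may depend on the function
  to which the operator is applied, so only countably many test functions can be used together.
  Finitely many suffice: with a strictly positive weight \<open>w\<close> small enough for all \<open>w * g k\<close> to lie
  in \<open>L_p\<close>, testing against \<open>w * g k\<close>, multiplying by \<open>f k t\<close> and summing over \<open>k\<close> gives
  \<open>\<integral> w(s) K(t, s)\<^sup>2 ds = 0\<close> for almost every \<open>t\<close>.
\<close>

section \<open>Functions in \<open>L_p\<close>\<close>

lemma Lp_fun_measurable [measurable_dest]: "f \<in> Lp_fun p M \<Longrightarrow> f \<in> borel_measurable M"
  by (simp add: Lp_fun_def)

lemma Lp_fun_topD: "f \<in> Lp_fun \<infinity> M \<Longrightarrow> \<exists>C. AE x in M. \<bar>f x\<bar> \<le> C"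
  by (simp add: Lp_fun_def)

lemma Lp_fun_integrableD: "f \<in> Lp_fun p M \<Longrightarrow> p \<noteq> \<infinity> \<Longrightarrow> integrable M (\<lambda>x. \<bar>f x\<bar> powr enn2real p)"
  by (simp add: Lp_fun_def)

lemma zero_in_Lp_fun: "(\<lambda>x. 0) \<in> Lp_fun p M"
  by (auto simp: Lp_fun_def intro: exI[of _ 0])

lemma scale_in_Lp_fun:
  assumes "f \<in> Lp_fun p M"
  shows "(\<lambda>x. r * f x) \<in> Lp_fun p M"
  supply assms [measurable]
proof (cases "p = \<infinity>")
  case True
  with Lp_fun_topD assms obtain C where "AE x in M. \<bar>f x\<bar> \<le> C" by blast
  then have "AE x in M. \<bar>r * f x\<bar> \<le> \<bar>r\<bar> * C"
    by (rule AE_mp) (simp add: abs_mult mult_left_mono)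
  with True assms show ?thesis by (auto simp: Lp_fun_def)
next
  case False
  with assms have "integrable M (\<lambda>x. \<bar>r\<bar> powr enn2real p * \<bar>f x\<bar> powr enn2real p)"
    by (intro integrable_mult_right Lp_fun_integrableD)
  moreover have "(\<lambda>x. r * f x) \<in> borel_measurable M" by measurable
  ultimately show ?thesis
    using False by (simp add: Lp_fun_def abs_mult powr_mult)
qed

lemma add_in_Lp_fun:
  assumes f: "f \<in> Lp_fun p M" and g: "g \<in> Lp_fun p M"
  shows "(\<lambda>x. f x + g x) \<in> Lp_fun p M"
proof (cases "p = \<infinity>")
  case True
  with f g obtain C D where "AE x in M. \<bar>f x\<bar> \<le> C" "AE x in M. \<bar>g x\<bar> \<le> D"
    by (metis Lp_fun_topD)
  then have "AE x in M. \<bar>f x + g x\<bar> \<le> C + D"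
    by eventually_elim linarith
  with True f g show ?thesis by (auto simp: Lp_fun_def)
next
  case False
  define r where "r = enn2real p"
  have r: "0 \<le> r" by (simp add: r_def)
  have [measurable]: "f \<in> borel_measurable M" "g \<in> borel_measurable M"
    using f g by (auto dest: Lp_fun_measurable)
  have int: "integrable M (\<lambda>x. 2 powr r * (\<bar>f x\<bar> powr r + \<bar>g x\<bar> powr r))"
    unfolding r_def by (intro integrable_mult_right Bochner_Integration.integrable_add Lp_fun_integrableD f g False)
  have bound: "\<bar>u + v\<bar> powr r \<le> 2 powr r * (\<bar>u\<bar> powr r + \<bar>v\<bar> powr r)" for u v :: real
  proof -
    have "\<bar>u + v\<bar> powr r \<le> (2 * max \<bar>u\<bar> \<bar>v\<bar>) powr r"
      by (rule powr_mono2[OF r]) auto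
    also have "\<dots> = 2 powr r * max \<bar>u\<bar> \<bar>v\<bar> powr r" by (simp add: powr_mult)
    also have "\<dots> \<le> 2 powr r * (\<bar>u\<bar> powr r + \<bar>v\<bar> powr r)"
      by (intro mult_left_mono) (auto simp: max_def)
    finally show ?thesis .
  qed
  have "integrable M (\<lambda>x. \<bar>f x + g x\<bar> powr r)"
    by (rule Bochner_Integration.integrable_bound[OF int]) (auto simp: bound)
  with False show ?thesis by (simp add: Lp_fun_def r_def)
qed

lemma sum_in_Lp_fun:
  "(\<And>i. i \<in> I \<Longrightarrow> f i \<in> Lp_fun p M) \<Longrightarrow> (\<lambda>x. \<Sum>i\<in>I. f i x) \<in> Lp_fun p M"
  by (induction I rule: infinite_finite_induct) (auto intro: add_in_Lp_fun zero_in_Lp_fun)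

text \<open>Extension by zero, so that all pairings below become integrals over the whole space. The
  values of \<open>f\<close> outside \<open>G\<close> are arbitrary and need not be measurable there.\<close>

lemma indicator_in_Lp_fun:
  assumes G: "G \<in> sets M" and f: "f \<in> Lp_fun p (restrict_space M G)"
  shows "(\<lambda>x. indicator G x * f x) \<in> Lp_fun p M"
proof -
  have G': "G \<inter> space M \<in> sets M" using G by auto
  have meas: "(\<lambda>x. indicator G x * f x) \<in> borel_measurable M"
    using f G' by (simp add: Lp_fun_def borel_measurable_restrict_space_iff)
  show ?thesis
  proof (cases "p = \<infinity>")
    case True
    with Lp_fun_topD f obtain C where "AE x in restrict_space M G. \<bar>f x\<bar> \<le> C" by blast
    then have "AE x in M. x \<in> G \<longrightarrow> \<bar>f x\<bar> \<le> C"
      using G' by (simp add: AE_restrict_space_iff)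
    then have "AE x in M. \<bar>indicator G x * f x\<bar> \<le> max C 0"
      by (rule AE_mp) (auto simp: indicator_def)
    with True meas show ?thesis by (auto simp: Lp_fun_def)
  next
    case False
    from Lp_fun_integrableD[OF f False]
    have "integrable M (\<lambda>x. indicator G x * \<bar>f x\<bar> powr enn2real p)"
      using G' by (simp add: integrable_restrict_space)
    also have "(\<lambda>x. indicator G x * \<bar>f x\<bar> powr enn2real p) = (\<lambda>x. \<bar>indicator G x * f x\<bar> powr enn2real p)"
      by (auto simp: indicator_def fun_eq_iff)
    finally show ?thesis using False meas by (simp add: Lp_fun_def)
  qed
qed

text \<open>Supplies test functions that lie in \<open>Lp_fun p M\<close> for every \<open>p \<ge> 1\<close> at once, the
  case \<open>p = \<infinity>\<close> included: being at most one in absolute value turns the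
  \<open>p\<close>-th power into something below the first power.\<close>

lemma bounded_integrable_in_Lp_fun:
  assumes "1 \<le> p" and [measurable]: "f \<in> borel_measurable M" and int: "integrable M h"
    and le: "\<And>x. x\<in> space M \<Longrightarrow> \<bar>f x\<bar> \<le> 1" "\<And>x. x\<in> space M \<Longrightarrow> \<bar>f x\<bar> \<le> h x"
  shows "f \<in> Lp_fun p M"
proof (cases "p = \<infinity>")
  case True
  then show ?thesis using le by (auto simp: Lp_fun_def intro!: exI[of _ 1])
next
  case False
  then have r: "1 \<le> enn2real p"
    using enn2real_mono[of 1 p] \<open>1 \<le> p\<close> by (simp add: top.not_eq_extremum)
  have "integrable M (\<lambda>x. \<bar>f x\<bar> powr enn2real p)"
  proof (rule Bochner_Integration.integrable_bound[OF int])
    show "AE x in M. norm (\<bar>f x\<bar> powr enn2real p) \<le> norm (h x)"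
    proof (rule AE_I2)
      fix x assume x: "x \<in> space M"
      have "\<bar>f x\<bar> powr enn2real p \<le> \<bar>f x\<bar> powr 1"
        using powr_mono' [of 1 "enn2real p" "\<bar>f x\<bar>"] le(1)[OF x] r by auto
      then show "norm (\<bar>f x\<bar> powr enn2real p) \<le> norm (h x)"
        using le(2)[OF x] by simp
    qed
  qed simp
  with False show ?thesis by (simp add: Lp_fun_def)
qed

section \<open>The space of classes modulo null sets\<close>

lemma Lp_rel_equiv: "equiv (Lp_fun p M) (Lp_rel p M)"
proof (rule equivI)
  show "Lp_rel p M \<subseteq> Lp_fun p M \<times> Lp_fun p M" by (auto simp: Lp_rel_def)
  show "refl_on (Lp_fun p M) (Lp_rel p M)" by (auto simp: Lp_rel_def refl_on_def)
  show "sym (Lp_rel p M)" by (auto simp: Lp_rel_def sym_def)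
  show "trans (Lp_rel p M)"
    by (auto simp: Lp_rel_def trans_def)
qed

lemma Lp_space_nonempty: "U \<in> Lp_space p M \<Longrightarrow> \<exists>x. x \<in> U"
  unfolding Lp_space_def using in_quotient_imp_non_empty[OF Lp_rel_equiv] by fast

lemma Lp_space_member: "U \<in> Lp_space p M \<Longrightarrow> x \<in> U \<Longrightarrow> x \<in> Lp_fun p M"
  unfolding Lp_space_def using in_quotient_imp_subset[OF Lp_rel_equiv] by fast

lemma Lp_class_in_space: "x \<in> Lp_fun p M \<Longrightarrow> Lp_rel p M `` {x} \<in> Lp_space p M"
  unfolding Lp_space_def by (rule quotientI)

lemma Lp_class_self: "x \<in> Lp_fun p M \<Longrightarrow> x \<in> Lp_rel p M `` {x}"
  by (simp add: Lp_rel_def)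

lemma Lp_space_eq_iff:
  assumes "U \<in> Lp_space p M" "V \<in> Lp_space p M" "x \<in> U" "y \<in> V"
  shows "U = V \<longleftrightarrow> (AE t in M. x t = y t)"
proof -
  have "U = V \<longleftrightarrow> (x, y) \<in> Lp_rel p M"
    using assms unfolding Lp_space_def
    by (metis Lp_rel_equiv quotient_eqI quotient_eq_iff)
  also have "\<dots> \<longleftrightarrow> (AE t in M. x t = y t)"
    using assms Lp_space_member[of _ p M] by (auto simp: Lp_rel_def)
  finally show ?thesis .
qed

text \<open>The lifted operations are unions over all representatives; these two lemmas show that the
  union collapses to the class obtained from any single choice.\<close>

lemma Lp_scale_class:
  assumes U: "U \<in> Lp_space p M" and x: "x \<in> U"
  shows "Lp_scale p M r U = Lp_rel p M `` {\<lambda>t. r * x t}"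
proof -
  have "Lp_rel p M `` {\<lambda>t. r * y t} = Lp_rel p M `` {\<lambda>t. r * x t}" if y: "y \<in> U" for y
  proof -
    have "AE t in M. y t = x t" using Lp_space_eq_iff[OF U U y x] by simp
    then have "AE t in M. r * y t = r * x t" by eventually_elim simp
    moreover have "(\<lambda>t. r * y t) \<in> Lp_fun p M" "(\<lambda>t. r * x t) \<in> Lp_fun p M"
      by (intro scale_in_Lp_fun Lp_space_member[OF U] x y)+
    ultimately show ?thesis
      by (intro equiv_class_eq[OF Lp_rel_equiv]) (simp add: Lp_rel_def)
  qed
  then have "Lp_scale p M r U = (\<Union>y\<in>U. Lp_rel p M `` {\<lambda>t. r * x t})"
    unfolding Lp_scale_def by (intro SUP_cong refl)
  then show ?thesis using x by blast
qed

lemma Lp_add_class: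
  assumes U: "U \<in> Lp_space p M" and V: "V \<in> Lp_space p M" and x: "x \<in> U" and y: "y \<in> V"
  shows "Lp_add p M U V = Lp_rel p M `` {\<lambda>t. x t + y t}"
proof -
  have "Lp_rel p M `` {\<lambda>t. x' t + y' t} = Lp_rel p M `` {\<lambda>t. x t + y t}"
    if x': "x' \<in> U" and y': "y' \<in> V" for x' y'
  proof -
    have "AE t in M. x' t = x t" "AE t in M. y' t = y t"
      using Lp_space_eq_iff[OF U U x' x] Lp_space_eq_iff[OF V V y' y] by simp_all
    then have "AE t in M. x' t + y' t = x t + y t" by eventually_elim simp
    moreover have "(\<lambda>t. x' t + y' t) \<in> Lp_fun p M" "(\<lambda>t. x t + y t) \<in> Lp_fun p M"
      by (intro add_in_Lp_fun Lp_space_member[OF U] Lp_space_member[OF V] x y x' y')+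
    ultimately show ?thesis
      by (intro equiv_class_eq[OF Lp_rel_equiv]) (simp add: Lp_rel_def)
  qed
  then have "Lp_add p M U V = (\<Union>x'\<in>U. \<Union>y'\<in>V. Lp_rel p M `` {\<lambda>t. x t + y t})"
    unfolding Lp_add_def by (intro SUP_cong refl)
  then show ?thesis using x y by blast
qed

lemma Lp_scale_in_space: "U \<in> Lp_space p M \<Longrightarrow> Lp_scale p M r U \<in> Lp_space p M"
  using Lp_space_nonempty[of U p M]
  by (auto simp: Lp_scale_class intro!: Lp_class_in_space scale_in_Lp_fun Lp_space_member)

lemma Lp_add_in_space:
  "U \<in> Lp_space p M \<Longrightarrow> V \<in> Lp_space p M \<Longrightarrow> Lp_add p M U V \<in> Lp_space p M"
proof -
  assume U: "U \<in> Lp_space p M" and V: "V \<in> Lp_space p M"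
  obtain x y where x: "x \<in> U" and y: "y \<in> V" using U V Lp_space_nonempty by blast
  show ?thesis
    unfolding Lp_add_class[OF U V x y]
    by (intro Lp_class_in_space add_in_Lp_fun Lp_space_member[OF U x] Lp_space_member[OF V y])
qed

section \<open>Pairing of conjugate exponents\<close>

lemma conjugate_exponent_of_top:
  fixes q :: ennreal
  assumes "1 / \<infinity> + 1 / q = 1" "1 \<le> q"
  shows "q = 1"
proof -
  have q: "1 / q = 1" using assms(1) by simp
  show ?thesis
  proof (cases q rule: ennreal_cases)
    case (real r)
    then have r: "1 \<le> r" using assms(2) by (metis ennreal_1 ennreal_le_iff)
    have "ennreal (1 / r) = ennreal 1"
      using q r divide_ennreal[of 1 r] unfolding real by simp
    with r show ?thesis by (simp add: real divide_simps)
  next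
    case top
    with q show ?thesis by simp
  qed
qed

lemma conjugate_exponents_real:
  fixes p q :: ennreal
  assumes pq: "1 / p + 1 / q = 1" and fin: "p \<noteq> \<infinity>" "q \<noteq> \<infinity>" and ge: "1 \<le> p" "1 \<le> q"
  shows "1 < enn2real p" "1 < enn2real q" "1 / enn2real p + 1 / enn2real q = 1"
proof -
  obtain r where r: "p = ennreal r" "0 \<le> r" using fin by (cases p rule: ennreal_cases) auto
  obtain s where s: "q = ennreal s" "0 \<le> s" using fin by (cases q rule: ennreal_cases) auto
  have ge': "1 \<le> r" "1 \<le> s" using ge r s by (metis ennreal_1 ennreal_le_iff)+
  have "ennreal (1 / r + 1 / s) = ennreal 1"
    using pq r s ge' divide_ennreal[of 1 r] divide_ennreal[of 1 s] by simp
  then have sum: "1 / r + 1 / s = 1" using ge' by (subst (asm) ennreal_inj) auto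
  moreover have "0 < 1 / r" "0 < 1 / s" using ge' by auto
  ultimately have "1 / r < 1" "1 / s < 1" by linarith+
  then have "1 < r" "1 < s" using ge' by (auto simp: divide_simps)
  with sum r s show "1 < enn2real p" "1 < enn2real q" "1 / enn2real p + 1 / enn2real q = 1"
    by simp_all
qed

lemma integrable_bounded_mult:
  fixes f g :: "'a \<Rightarrow> real"
  assumes "f \<in> Lp_fun \<infinity> M" "g \<in> Lp_fun 1 M"
  shows "integrable M (\<lambda>x. g x * f x)"
proof -
  from assms(1) obtain C where C: "AE x in M. \<bar>f x\<bar> \<le> C" by (metis Lp_fun_topD)
  have "integrable M (\<lambda>x. C * \<bar>g x\<bar>)"
    using Lp_fun_integrableD[OF assms(2)] by simp
  moreover have "AE x in M. norm (g x * f x) \<le> norm (C * \<bar>g x\<bar>)"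
    using C
  proof eventually_elim
    case (elim x)
    then have "\<bar>g x\<bar> * \<bar>f x\<bar> \<le> \<bar>g x\<bar> * \<bar>C\<bar>" by (intro mult_left_mono) auto
    then show ?case by (simp add: abs_mult mult.commute)
  qed
  moreover have "(\<lambda>x. g x * f x) \<in> borel_measurable M"
    using assms by measurable
  ultimately show ?thesis
    using Bochner_Integration.integrable_bound by blast
qed

locale conjugate_exponents = sigma_finite_measure M for M :: "'a measure" +
  fixes p q :: ennreal
  assumes p_ge_1: "1 \<le> p" and q_ge_1: "1 \<le> q" and conjugate: "1 / p + 1 / q = 1"
begin

text \<open>When both exponents are finite, Young's inequality bounds the product pointwise by an
  integrable function; otherwise one factor is essentially bounded and the other integrable.\<close>

lemma integrable_mult_Lp:
  assumes f: "f \<in> Lp_fun p M" and g: "g \<in> Lp_fun q M"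
  shows "integrable M (\<lambda>x. g x * f x)"
proof -
  consider (p) "p = \<infinity>" | (q) "q = \<infinity>" | (fin) "p \<noteq> \<infinity>" "q \<noteq> \<infinity>" by blast
  then show ?thesis
  proof cases
    case p
    then have "q = 1" using conjugate_exponent_of_top[of q] conjugate q_ge_1 by simp
    with p f g integrable_bounded_mult[of f M g] show ?thesis by simp
  next
    case q
    then have "p = 1" using conjugate_exponent_of_top[of p] conjugate p_ge_1 by (simp add: add.commute)
    with q f g have "integrable M (\<lambda>x. f x * g x)" using integrable_bounded_mult[of g M f] by simp
    then show ?thesis by (simp add: mult.commute)
  next
    case fin
    define r s where "r = enn2real p" and "s = enn2real q"
    note rs = conjugate_exponents_real[OF conjugate fin p_ge_1 q_ge_1, folded r_def s_def]
    have int: "integrable M (\<lambda>x. \<bar>g x\<bar> powr s / s + \<bar>f x\<bar> powr r / r)"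
      unfolding r_def s_def
      by (intro Bochner_Integration.integrable_add integrable_divide Lp_fun_integrableD f g fin)
    have "norm (g x * f x) \<le> norm (\<bar>g x\<bar> powr s / s + \<bar>f x\<bar> powr r / r)" for x
      using Youngs_inequality[of s r "\<bar>g x\<bar>" "\<bar>f x\<bar>"] rs
      by (auto simp: abs_mult)
    moreover have "(\<lambda>x. g x * f x) \<in> borel_measurable M"
      using f g by measurable
    ultimately show ?thesis
      by (intro Bochner_Integration.integrable_bound[OF int]) auto
  qed
qed

section \<open>Separable kernels\<close>

sublocale MM: pair_sigma_finite M M ..

lemma integral_separable_kernel:
  assumes "\<And>i. i \<in> I \<Longrightarrow> g i \<in> Lp_fun q M" and x: "x \<in> Lp_fun p M"
  shows "(\<Sum>i\<in>I. r i * (LINT s|M. g i s * x s)) = (LINT s|M. (\<Sum>i\<in>I. r i * g i s) * x s)"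
    and "integrable M (\<lambda>s. (\<Sum>i\<in>I. r i * g i s) * x s)"
proof -
  have int: "integrable M (\<lambda>s. r i * (g i s * x s))" if "i \<in> I" for i
    using that assms by (intro integrable_mult_right integrable_mult_Lp)
  have eq: "(\<lambda>s. (\<Sum>i\<in>I. r i * g i s) * x s) = (\<lambda>s. \<Sum>i\<in>I. r i * (g i s * x s))"
    by (simp add: sum_distrib_right mult.assoc)
  show "integrable M (\<lambda>s. (\<Sum>i\<in>I. r i * g i s) * x s)"
    unfolding eq using int by (rule Bochner_Integration.integrable_sum)
  show "(\<Sum>i\<in>I. r i * (LINT s|M. g i s * x s)) = (LINT s|M. (\<Sum>i\<in>I. r i * g i s) * x s)"
    unfolding eq using int by (subst Bochner_Integration.integral_sum) simp_all
qed

text \<open>A separable kernel is determined almost everywhere by the operator that it induces. From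
  operator to kernel, the test functions are the \<open>g k\<close> themselves, damped by a weight \<open>w\<close>; since
  there are finitely many of them, one null set of \<open>t\<close> serves all.\<close>

theorem separable_kernel_zero_iff:
  fixes f g :: "'i \<Rightarrow> 'a \<Rightarrow> real"
  assumes I: "finite I"
    and f: "\<And>i. i \<in> I \<Longrightarrow> f i \<in> borel_measurable M"
    and g: "\<And>i. i \<in> I \<Longrightarrow> g i \<in> Lp_fun q M"
  shows "(\<forall>x\<in>Lp_fun p M. AE t in M. (\<Sum>i\<in>I. f i t * (LINT s|M. g i s * x s)) = 0) \<longleftrightarrow>
    (AE (t, s) in M \<Otimes>\<^sub>M M. (\<Sum>i\<in>I. f i t * g i s) = 0)"
proof
  assume "AE (t, s) in M \<Otimes>\<^sub>M M. (\<Sum>i\<in>I. f i t * g i s) = 0"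
  from MM.AE_pair[OF this] have ae: "AE t in M. AE s in M. (\<Sum>i\<in>I. f i t * g i s) = 0" by simp
  show "\<forall>x\<in>Lp_fun p M. AE t in M. (\<Sum>i\<in>I. f i t * (LINT s|M. g i s * x s)) = 0"
  proof
    fix x assume x: "x \<in> Lp_fun p M"
    from ae show "AE t in M. (\<Sum>i\<in>I. f i t * (LINT s|M. g i s * x s)) = 0"
    proof eventually_elim
      case (elim t)
      then have "AE s in M. (\<Sum>i\<in>I. f i t * g i s) * x s = 0" by eventually_elim simp
      then show ?case
        by (subst integral_separable_kernel(1)[OF g x]) (simp_all add: integral_eq_zero_AE)
    qed
  qed
next
  assume zero: "\<forall>x\<in>Lp_fun p M. AE t in M. (\<Sum>i\<in>I. f i t * (LINT s|M. g i s * x s)) = 0"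
  obtain h :: "'a \<Rightarrow> real" where h: "h \<in> borel_measurable M" "\<And>s. 0 < h s" "\<And>s. h s \<le> 1" "integrable M h"
    using obtain_positive_integrable_function by metis
  note [measurable] = h(1) f Lp_fun_measurable[OF g]
  \<comment> \<open>The denominator dominates every \<open>\<bar>g k s\<bar>\<close>, hence \<open>\<bar>w * g k\<bar> \<le> h \<le> 1\<close> and \<open>w * g k\<close> lies in \<open>Lp_fun p M\<close>.\<close>
  define w where "w s = h s / (1 + (\<Sum>i\<in>I. (g i s)\<^sup>2))" for s
  have pos: "0 < 1 + (\<Sum>i\<in>I. (g i s)\<^sup>2)" for s
    by (intro add_pos_nonneg sum_nonneg) auto
  have w: "0 < w s" for s
    using h(2) pos by (simp add: w_def)
  have [measurable]: "w \<in> borel_measurable M"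
    unfolding w_def by measurable
  have le: "\<bar>w s * g k s\<bar> \<le> h s" if "k \<in> I" for k s
  proof -
    have "0 \<le> (\<bar>g k s\<bar> - 1)\<^sup>2" by simp
    then have "2 * \<bar>g k s\<bar> \<le> 1 + (g k s)\<^sup>2" by (simp add: power2_diff)
    moreover have "(g k s)\<^sup>2 \<le> (\<Sum>i\<in>I. (g i s)\<^sup>2)" using that I by (intro member_le_sum) auto
    ultimately have "\<bar>g k s\<bar> \<le> 1 + (\<Sum>i\<in>I. (g i s)\<^sup>2)" by linarith
    then have "h s * \<bar>g k s\<bar> \<le> h s * (1 + (\<Sum>i\<in>I. (g i s)\<^sup>2))"
      using h(2)[of s] by (intro mult_left_mono) auto
    then show ?thesis
      using h(2)[of s] pos[of s] by (simp add: w_def abs_mult divide_simps)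
  qed
  have x: "(\<lambda>s. w s * g k s) \<in> Lp_fun p M" if k: "k \<in> I" for k
  proof (rule bounded_integrable_in_Lp_fun[OF p_ge_1 _ h(4)])
    show "(\<lambda>s. w s * g k s) \<in> borel_measurable M" using k by measurable
  qed (use le[OF k] h(3) order_trans in blast)+
  have "AE t in M. \<forall>k\<in>I. (\<Sum>i\<in>I. f i t * (LINT s|M. g i s * (w s * g k s))) = 0"
  proof (rule AE_finite_allI[OF I])
    fix k assume "k \<in> I"
    from bspec[OF zero x[OF this]]
    show "AE t in M. (\<Sum>i\<in>I. f i t * (LINT s|M. g i s * (w s * g k s))) = 0" .
  qed
  then have "AE t in M. AE s in M. (\<Sum>i\<in>I. f i t * g i s) = 0"
  proof eventually_elim
    case (elim t)
    define K where "K s = (\<Sum>i\<in>I. f i t * g i s)" for s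
    have zero': "(LINT s|M. K s * (w s * g k s)) = 0" if "k \<in> I" for k
      using bspec[OF elim that] integral_separable_kernel(1)[where I=I and g=g and r="\<lambda>i. f i t", OF g x[OF that]]
      by (simp add: K_def)
    have int: "integrable M (\<lambda>s. f k t * (K s * (w s * g k s)))" if "k \<in> I" for k
      unfolding K_def using integral_separable_kernel(2)[OF g x[OF that]]
      by (intro integrable_mult_right)
    \<comment> \<open>The tests against the \<open>g k\<close>, combined with coefficients \<open>f k t\<close>, amount to testing \<open>K\<close> against \<open>w * K\<close>.\<close>
    have eq: "(\<lambda>s. \<Sum>k\<in>I. f k t * (K s * (w s * g k s))) = (\<lambda>s. w s * (K s)\<^sup>2)"
      by (auto simp: K_def power2_eq_square sum_distrib_left sum_distrib_right mult_ac intro!: ext sum.cong)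
    have "integrable M (\<lambda>s. w s * (K s)\<^sup>2)"
      unfolding eq[symmetric] using int by (rule Bochner_Integration.integrable_sum)
    moreover have "(LINT s|M. w s * (K s)\<^sup>2) = 0"
      unfolding eq[symmetric] using int zero' by (subst Bochner_Integration.integral_sum) simp_all
    ultimately have "AE s in M. w s * (K s)\<^sup>2 = 0"
      using w by (subst (asm) integral_nonneg_eq_0_iff_AE) (auto simp: less_imp_le)
    then show ?case
      using w by (auto simp: K_def less_le)
  qed
  moreover have "{z \<in> space (M \<Otimes>\<^sub>M M). (\<lambda>(t, s). (\<Sum>i\<in>I. f i t * g i s) = 0) z} \<in> sets (M \<Otimes>\<^sub>M M)"
    by measurable
  ultimately show "AE (t, s) in M \<Otimes>\<^sub>M M. (\<Sum>i\<in>I. f i t * g i s) = 0"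
    by (intro MM.AE_pair_measure) simp_all
qed

section \<open>The bilinear form \<open>Q\<close>\<close>

lemma Q_as_integral: "Q M S g x = (LINT s|M. (indicator S s * g s) * x s)"
  by (simp add: Q_def set_lebesgue_integral_def mult.assoc)

lemma Q_scale: "Q M S g (\<lambda>t. r * x t) = r * Q M S g x"
  by (simp add: Q_as_integral mult.left_commute[of _ r])

lemma Q_cong_AE:
  assumes S: "S \<in> sets M" and g: "g \<in> Lp_fun q (restrict_space M S)"
    and [measurable]: "x \<in> borel_measurable M" "y \<in> borel_measurable M" and eq: "AE t in M. x t = y t"
  shows "Q M S g x = Q M S g y"
proof -
  note [measurable] = Lp_fun_measurable[OF indicator_in_Lp_fun[OF S g]]
  show ?thesis
    unfolding Q_as_integral using eq by (intro integral_cong_AE) auto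
qed

lemma Q_add:
  assumes S: "S \<in> sets M" and g: "g \<in> Lp_fun q (restrict_space M S)"
    and x: "x \<in> Lp_fun p M" and y: "y \<in> Lp_fun p M"
  shows "Q M S g (\<lambda>t. x t + y t) = Q M S g x + Q M S g y"
  unfolding Q_as_integral distrib_left
  by (intro Bochner_Integration.integral_add integrable_mult_Lp indicator_in_Lp_fun S g x y)

lemma Q_sum:
  assumes S: "S \<in> sets M" and g: "g \<in> Lp_fun q (restrict_space M S)"
    and x: "\<And>j. j \<in> J \<Longrightarrow> x j \<in> Lp_fun p M"
  shows "Q M S g (\<lambda>t. \<Sum>j\<in>J. x j t) = (\<Sum>j\<in>J. Q M S g (x j))"
  unfolding Q_as_integral sum_distrib_left
  by (intro Bochner_Integration.integral_sum integrable_mult_Lp indicator_in_Lp_fun S g x)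

lemma integral_finite_rank_kernel:
  assumes S: "S \<in> sets M" and c: "\<And>i. i \<in> I \<Longrightarrow> c i \<in> Lp_fun q (restrict_space M S)"
    and x: "x \<in> Lp_fun p M"
  shows "(LINT s:S|M. (\<Sum>i\<in>I. r i * c i s * x s)) = (\<Sum>i\<in>I. r i * Q M S (c i) x)"
proof -
  have "(LINT s:S|M. (\<Sum>i\<in>I. r i * c i s * x s))
      = (LINT s|M. (\<Sum>i\<in>I. r i * (indicator S s * c i s)) * x s)"
    unfolding set_lebesgue_integral_def
    by (simp add: sum_distrib_left sum_distrib_right mult_ac)
  also have "\<dots> = (\<Sum>i\<in>I. r i * Q M S (c i) x)"
    unfolding Q_as_integral
    by (rule integral_separable_kernel(1)[symmetric]) (auto intro: indicator_in_Lp_fun S c x)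
  finally show ?thesis .
qed

end

section \<open>Sums over chains of indices\<close>

lemma sum_PiE_Suc:
  "(\<Sum>f\<in>{1..Suc j} \<rightarrow>\<^sub>E T. F f) = (\<Sum>f\<in>{1..j} \<rightarrow>\<^sub>E T. \<Sum>y\<in>T. F (f(Suc j := y)))"
proof -
  have inj: "inj_on (\<lambda>(y, f). f(Suc j := y)) (T \<times> ({1..j} \<rightarrow>\<^sub>E T))"
    using inj_combinator[of "Suc j" "{1..j}" "\<lambda>_. T"] by simp
  have "(\<Sum>f\<in>{1..Suc j} \<rightarrow>\<^sub>E T. F f) = (\<Sum>f\<in>insert (Suc j) {1..j} \<rightarrow>\<^sub>E T. F f)"
    by (simp add: atLeastAtMostSuc_conv)
  also have "\<dots> = (\<Sum>(y, f)\<in>T \<times> ({1..j} \<rightarrow>\<^sub>E T). F (f(Suc j := y)))"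
    unfolding PiE_insert_eq
    by (subst sum.reindex[OF inj]) (simp add: case_prod_unfold)
  also have "\<dots> = (\<Sum>y\<in>T. \<Sum>f\<in>{1..j} \<rightarrow>\<^sub>E T. F (f(Suc j := y)))"
    by (simp add: sum.cartesian_product)
  also have "\<dots> = (\<Sum>f\<in>{1..j} \<rightarrow>\<^sub>E T. \<Sum>y\<in>T. F (f(Suc j := y)))"
    by (rule sum.swap)
  finally show ?thesis .
qed

text \<open>A chain of triples is a triple of chains. Single-index families with chains of indices make
  the algebra below short; these identities return to nested sums over the components.\<close>

lemma sum_PiE_Times:
  "(\<Sum>z\<in>S \<rightarrow>\<^sub>E X \<times> Y. F z) = (\<Sum>f\<in>S \<rightarrow>\<^sub>E X. \<Sum>g\<in>S \<rightarrow>\<^sub>E Y. F (\<lambda>v\<in>S. (f v, g v)))"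
proof -
  have "(\<Sum>z\<in>S \<rightarrow>\<^sub>E X \<times> Y. F z)
      = (\<Sum>(f, g)\<in>(S \<rightarrow>\<^sub>E X) \<times> (S \<rightarrow>\<^sub>E Y). F (\<lambda>v\<in>S. (f v, g v)))"
    by (rule sum.reindex_bij_witness[where j="\<lambda>z. (restrict (fst \<circ> z) S, restrict (snd \<circ> z) S)"
          and i="\<lambda>(f, g). restrict (\<lambda>v. (f v, g v)) S"])
       (auto simp: fun_eq_iff PiE_iff extensional_def restrict_def mem_Times_iff intro!: arg_cong[of _ _ F])
  then show ?thesis by (simp add: sum.cartesian_product)
qed

lemma sum_PiE_triples:
  fixes S :: "'s set" and X :: "'x set" and Y :: "'y set" and Z :: "'z set"
  shows
  "(\<Sum>z\<in>S \<rightarrow>\<^sub>E X \<times> Y \<times> Z. F z)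
    = (\<Sum>f\<in>S \<rightarrow>\<^sub>E X. \<Sum>g\<in>S \<rightarrow>\<^sub>E Y. \<Sum>h\<in>S \<rightarrow>\<^sub>E Z. F (\<lambda>v\<in>S. (f v, g v, h v)))"
proof -
  have "(\<lambda>v\<in>S. (f v, (\<lambda>v\<in>S. (g v, h v)) v)) = (\<lambda>v\<in>S. (f v, g v, h v))"
    for f :: "'s \<Rightarrow> 'x" and g :: "'s \<Rightarrow> 'y" and h :: "'s \<Rightarrow> 'z" and S
    by (rule restrict_ext) simp
  then show ?thesis unfolding sum_PiE_Times by (simp only:)
qed

lemma sum_triples:
  "(\<Sum>z\<in>X \<times> Y \<times> Z. F z) = (\<Sum>x\<in>X. \<Sum>y\<in>Y. \<Sum>z\<in>Z. F (x, y, z))"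
  by (simp add: sum.cartesian_product)

section \<open>Powers and polynomials of a finite-rank operator\<close>

text \<open>The triples that index the summands enter only as labels, so the index type is arbitrary.\<close>

locale finite_rank_operator = conjugate_exponents M p q
  for M :: "'a measure" and p q +
  fixes S :: "'a set" and I :: "'i set" and \<gamma> :: "'i \<Rightarrow> real" and a c :: "'i \<Rightarrow> 'a \<Rightarrow> real"
    and T :: "('a \<Rightarrow> real) set \<Rightarrow> ('a \<Rightarrow> real) set"
  assumes S: "S \<in> sets M" and I: "finite I"
    and a: "\<And>i. i \<in> I \<Longrightarrow> a i \<in> Lp_fun p M"
    and c: "\<And>i. i \<in> I \<Longrightarrow> c i \<in> Lp_fun q (restrict_space M S)"
    and T: "T \<in> Lp_space p M \<rightarrow> Lp_space p M"
    and apply_AE: "\<And>U x y. U \<in> Lp_space p M \<Longrightarrow> x \<in> U \<Longrightarrow> y \<in> T U \<Longrightarrow>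
      AE t in M. y t = (\<Sum>i\<in>I. \<gamma> i * a i t * Q M S (c i) x)"
begin

text \<open>The coefficient of the term \<open>a (z 1) t * c (z j) s\<close> in the kernel of the \<open>j\<close>-th power: one
  factor \<open>\<gamma>\<close> per link and one pairing per joint between consecutive links.\<close>

definition chain_weight :: "nat \<Rightarrow> (nat \<Rightarrow> 'i) \<Rightarrow> real" where
  "chain_weight j z = (\<Prod>v=1..<j. Q M S (a (z (v + 1))) (c (z v))) * (\<Prod>v=1..j. \<gamma> (z v))"

lemma chain_weight_one: "chain_weight 1 z = \<gamma> (z 1)"
  by (simp add: chain_weight_def)

lemma chain_weight_Suc:
  assumes "1 \<le> j"
  shows "chain_weight (Suc j) (z(Suc j := i)) = chain_weight j z * (\<gamma> i * Q M S (a i) (c (z j)))"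
proof -
  let ?z = "z(Suc j := i)"
  have "(\<Prod>v=1..<j. Q M S (a (?z (v + 1))) (c (?z v))) = (\<Prod>v=1..<j. Q M S (a (z (v + 1))) (c (z v)))"
    by (intro prod.cong) auto
  moreover have "(\<Prod>v=1..j. \<gamma> (?z v)) = (\<Prod>v=1..j. \<gamma> (z v))"
    by (intro prod.cong) auto
  moreover have "(\<Prod>v=1..<Suc j. Q M S (a (?z (v + 1))) (c (?z v)))
      = (\<Prod>v=1..<j. Q M S (a (?z (v + 1))) (c (?z v))) * Q M S (a i) (c (z j))"
    unfolding prod.atLeastLessThan_Suc[OF assms] by simp
  moreover have "(\<Prod>v=1..Suc j. \<gamma> (?z v)) = \<gamma> i * (\<Prod>v=1..j. \<gamma> (?z v))"
    by (subst prod.nat_ivl_Suc') simp_all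
  ultimately show ?thesis
    unfolding chain_weight_def by (simp only: mult_ac)
qed

lemma pow_in_space: "U \<in> Lp_space p M \<Longrightarrow> (T ^^ j) U \<in> Lp_space p M"
  by (induction j) (use T in auto)

lemma chain_member: "z \<in> {1..j} \<rightarrow>\<^sub>E I \<Longrightarrow> 1 \<le> v \<Longrightarrow> v \<le> j \<Longrightarrow> z v \<in> I"
  using PiE_mem[of z "{1..j}" "\<lambda>_. I" v] by simp

lemma Q_apply:
  assumes "U \<in> Lp_space p M" "x \<in> U" "y \<in> T U"
    and S': "S' \<in> sets M" and g: "g \<in> Lp_fun q (restrict_space M S')"
  shows "Q M S' g y = (\<Sum>i\<in>I. \<gamma> i * Q M S' g (a i) * Q M S (c i) x)"
proof -
  have TU: "T U \<in> Lp_space p M" using T assms by auto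
  have "Q M S' g y = Q M S' g (\<lambda>t. \<Sum>i\<in>I. (\<gamma> i * Q M S (c i) x) * a i t)"
  proof (rule Q_cong_AE[OF S' g])
    show "y \<in> borel_measurable M" using Lp_space_member[OF TU assms(3)] by (rule Lp_fun_measurable)
    show "(\<lambda>t. \<Sum>i\<in>I. (\<gamma> i * Q M S (c i) x) * a i t) \<in> borel_measurable M"
      by (intro Lp_fun_measurable[where p=p] sum_in_Lp_fun scale_in_Lp_fun a)
    show "AE t in M. y t = (\<Sum>i\<in>I. (\<gamma> i * Q M S (c i) x) * a i t)"
      using apply_AE[OF assms(1-3)] by (simp add: mult_ac)
  qed
  also have "\<dots> = (\<Sum>i\<in>I. Q M S' g (\<lambda>t. (\<gamma> i * Q M S (c i) x) * a i t))"
    by (intro Q_sum[OF S' g] scale_in_Lp_fun a)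
  also have "\<dots> = (\<Sum>i\<in>I. \<gamma> i * Q M S' g (a i) * Q M S (c i) x)"
    unfolding Q_scale by (simp only: mult_ac)
  finally show ?thesis .
qed

text \<open>By induction, with the new factor \<open>T\<close> applied first, i.e. to the argument \<open>x\<close>. It then
  extends the chain at its end, so the links already present keep their positions.\<close>

lemma pow_apply_AE:
  assumes "1 \<le> j" "U \<in> Lp_space p M" "x \<in> U" "y \<in> (T ^^ j) U"
  shows "AE t in M. y t = (\<Sum>z\<in>{1..j} \<rightarrow>\<^sub>E I. chain_weight j z * a (z 1) t * Q M S (c (z j)) x)"
  using assms
proof (induction j arbitrary: U x y rule: nat_induct_at_least)
  case base
  have "(\<Sum>z\<in>{1..1} \<rightarrow>\<^sub>E I. chain_weight 1 z * a (z 1) t * Q M S (c (z 1)) x)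
      = (\<Sum>i\<in>I. \<gamma> i * a i t * Q M S (c i) x)" for t
    using sum_PiE_Suc[of "\<lambda>z. chain_weight 1 z * a (z 1) t * Q M S (c (z 1)) x" 0 I]
    by (simp add: chain_weight_one[unfolded One_nat_def])
  with apply_AE[of U x y] base show ?case by simp
next
  case (Suc j)
  have TU: "T U \<in> Lp_space p M" using T Suc.prems by auto
  then obtain x' where x': "x' \<in> T U" using Lp_space_nonempty by blast
  have y: "y \<in> (T ^^ j) (T U)" using Suc.prems by (simp add: funpow_swap1)
  have "(\<Sum>z\<in>{1..j} \<rightarrow>\<^sub>E I. chain_weight j z * a (z 1) t * Q M S (c (z j)) x')
     = (\<Sum>z\<in>{1..Suc j} \<rightarrow>\<^sub>E I. chain_weight (Suc j) z * a (z 1) t * Q M S (c (z (Suc j))) x)" for t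
    unfolding sum_PiE_Suc
  proof (intro sum.cong refl)
    fix z assume z: "z \<in> {1..j} \<rightarrow>\<^sub>E I"
    have zj: "z j \<in> I" using z Suc.hyps by (intro chain_member) auto
    have sym: "Q M S (a i) (c (z j)) = Q M S (c (z j)) (a i)" for i
      by (simp add: Q_def mult.commute)
    show "chain_weight j z * a (z 1) t * Q M S (c (z j)) x' =
      (\<Sum>i\<in>I. chain_weight (Suc j) (z(Suc j := i)) * a ((z(Suc j := i)) 1) t
         * Q M S (c ((z(Suc j := i)) (Suc j))) x)"
      using Suc.hyps unfolding Q_apply[OF Suc.prems(1,2) x' S c[OF zj]] chain_weight_Suc[OF Suc.hyps]
      by (auto simp: sum_distrib_left sym mult_ac intro!: sum.cong)
  qed
  then show ?case using Suc.IH[OF TU x' y] by (simp only:)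
qed

lemma poly_op_in_space:
  "U \<in> Lp_space p M \<Longrightarrow> poly_op p M \<delta> T n U \<in> Lp_space p M"
proof (induction n)
  case 0
  then show ?case by (auto intro: Lp_scale_in_space)
next
  case (Suc n)
  then show ?case
    unfolding poly_op.simps by (intro Lp_add_in_space Lp_scale_in_space pow_in_space)
qed

lemma poly_op_apply_AE:
  assumes U: "U \<in> Lp_space p M" and x: "x \<in> U"
  shows "y \<in> poly_op p M \<delta> T n U \<Longrightarrow> AE t in M. y t = \<delta> 0 * x t +
    (\<Sum>j=1..n. \<Sum>z\<in>{1..j} \<rightarrow>\<^sub>E I. \<delta> j * chain_weight j z * a (z 1) t * Q M S (c (z j)) x)"
proof (induction n arbitrary: y)
  case 0
  then show ?case
    by (simp add: Lp_scale_class[OF U x] Lp_rel_def eq_commute[of "y _"])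
next
  case (Suc n)
  let ?P = "poly_op p M \<delta> T n U" and ?V = "(T ^^ Suc n) U"
  let ?W = "Lp_scale p M (\<delta> (Suc n)) ?V"
  note V = pow_in_space[OF U, of "Suc n"] and P = poly_op_in_space[OF U, of \<delta> n]
  obtain x' y' where x': "x' \<in> ?P" and y': "y' \<in> ?V" using Lp_space_nonempty[OF V] Lp_space_nonempty[OF P] by blast
  have W: "?W \<in> Lp_space p M" "(\<lambda>t. \<delta> (Suc n) * y' t) \<in> ?W"
    unfolding Lp_scale_class[OF V y']
    by (intro Lp_class_in_space Lp_class_self scale_in_Lp_fun Lp_space_member[OF V y'])+
  have "y \<in> Lp_add p M ?P ?W" using Suc.prems by simp
  then have "AE t in M. x' t + \<delta> (Suc n) * y' t = y t"
    unfolding Lp_add_class[OF P W(1) x' W(2)] by (simp add: Lp_rel_def)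
  moreover have "AE t in M. y' t =
     (\<Sum>z\<in>{1..Suc n} \<rightarrow>\<^sub>E I. chain_weight (Suc n) z * a (z 1) t * Q M S (c (z (Suc n))) x)"
    by (rule pow_apply_AE[OF _ U x y']) simp
  ultimately show ?case
    using Suc.IH[OF x']
  proof eventually_elim
    case (elim t)
    show ?case
      unfolding elim(1)[symmetric] elim(2,3) by (simp add: sum_distrib_left mult.assoc)
  qed
qed

lemma Q_poly_op:
  assumes U: "U \<in> Lp_space p M" and x: "x \<in> U" and y: "y \<in> poly_op p M \<delta> T n U"
    and S': "S' \<in> sets M" and g: "g \<in> Lp_fun q (restrict_space M S')"
  shows "Q M S' g y = \<delta> 0 * Q M S' g x + (\<Sum>j=1..n. \<Sum>z\<in>{1..j} \<rightarrow>\<^sub>E I.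
    \<delta> j * chain_weight j z * Q M S' g (a (z 1)) * Q M S (c (z j)) x)"
proof -
  define h where "h j z t = (\<delta> j * chain_weight j z * Q M S (c (z j)) x) * a (z 1) t" for j z t
  have h: "h j z \<in> Lp_fun p M" if "j \<in> {1..n}" "z \<in> {1..j} \<rightarrow>\<^sub>E I" for j z
    unfolding h_def using that by (intro scale_in_Lp_fun a chain_member) auto
  have hs: "(\<lambda>t. \<Sum>z\<in>{1..j} \<rightarrow>\<^sub>E I. h j z t) \<in> Lp_fun p M" if "j \<in> {1..n}" for j
    using that by (intro sum_in_Lp_fun h)
  have hss: "(\<lambda>t. \<Sum>j=1..n. \<Sum>z\<in>{1..j} \<rightarrow>\<^sub>E I. h j z t) \<in> Lp_fun p M"
    by (intro sum_in_Lp_fun hs)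
  have x0: "(\<lambda>t. \<delta> 0 * x t) \<in> Lp_fun p M" by (intro scale_in_Lp_fun Lp_space_member[OF U x])
  have "Q M S' g y = Q M S' g (\<lambda>t. \<delta> 0 * x t + (\<Sum>j=1..n. \<Sum>z\<in>{1..j} \<rightarrow>\<^sub>E I. h j z t))"
  proof (rule Q_cong_AE[OF S' g])
    show "y \<in> borel_measurable M"
      using Lp_space_member[OF poly_op_in_space[OF U] y] by (rule Lp_fun_measurable)
    show "(\<lambda>t. \<delta> 0 * x t + (\<Sum>j=1..n. \<Sum>z\<in>{1..j} \<rightarrow>\<^sub>E I. h j z t)) \<in> borel_measurable M"
      by (intro Lp_fun_measurable[where p=p] add_in_Lp_fun x0 hss)
    show "AE t in M. y t = \<delta> 0 * x t + (\<Sum>j=1..n. \<Sum>z\<in>{1..j} \<rightarrow>\<^sub>E I. h j z t)"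
      using poly_op_apply_AE[OF U x y] by (simp add: h_def mult_ac)
  qed
  also have "\<dots> = \<delta> 0 * Q M S' g x + (\<Sum>j=1..n. Q M S' g (\<lambda>t. \<Sum>z\<in>{1..j} \<rightarrow>\<^sub>E I. h j z t))"
    unfolding Q_add[OF S' g x0 hss] Q_scale
    by (intro arg_cong2[of _ _ _ _ "(+)"] refl Q_sum[OF S' g] hs)
  also have "\<dots> = \<delta> 0 * Q M S' g x + (\<Sum>j=1..n. \<Sum>z\<in>{1..j} \<rightarrow>\<^sub>E I. Q M S' g (h j z))"
  proof (intro arg_cong2[of _ _ _ _ "(+)"] sum.cong refl)
    fix j assume "j \<in> {1..n}"
    then show "Q M S' g (\<lambda>t. \<Sum>z\<in>{1..j} \<rightarrow>\<^sub>E I. h j z t) = (\<Sum>z\<in>{1..j} \<rightarrow>\<^sub>E I. Q M S' g (h j z))"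
      by (intro Q_sum[OF S' g] h)
  qed
  also have "\<dots> = \<delta> 0 * Q M S' g x + (\<Sum>j=1..n. \<Sum>z\<in>{1..j} \<rightarrow>\<^sub>E I.
      \<delta> j * chain_weight j z * Q M S' g (a (z 1)) * Q M S (c (z j)) x)"
    unfolding h_def Q_scale by (simp add: mult_ac)
  finally show ?thesis .
qed

end

section \<open>The intertwining relation for two finite-rank operators\<close>

locale finite_rank_operator_pair =
  A: finite_rank_operator M p q GA IA \<gamma>A a c A + B: finite_rank_operator M p q GB IB \<gamma>B b e B
  for M :: "'a measure" and p q
    and GA and IA :: "'i set" and \<gamma>A a c A and GB and IB :: "'j set" and \<gamma>B b e B
begin

text \<open>Kernel of \<open>AB - \<delta> 0 B\<close>. The term \<open>\<delta> 0 B\<close> of \<open>BF(A)\<close> is counted here because it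
  acts through integration over \<open>GB\<close>, as \<open>AB\<close> does.\<close>

definition kernel_on_GB :: "(nat \<Rightarrow> real) \<Rightarrow> 'a \<Rightarrow> 'a \<Rightarrow> real" where
  "kernel_on_GB \<delta> t s = - (\<Sum>w\<in>IB. \<delta> 0 * \<gamma>B w * b w t * e w s)
    + (\<Sum>z\<in>IA. \<Sum>w\<in>IB. \<gamma>A z * \<gamma>B w * a z t * Q M GA (c z) (b w) * e w s)"

text \<open>Kernel of \<open>B\<close> composed with the part of \<open>F(A)\<close> of degree at least one, which acts through
  integration over \<open>GA\<close>.\<close>

definition kernel_on_GA :: "(nat \<Rightarrow> real) \<Rightarrow> nat \<Rightarrow> 'a \<Rightarrow> 'a \<Rightarrow> real" where
  "kernel_on_GA \<delta> n t s = (\<Sum>w\<in>IB. \<Sum>j=1..n. \<Sum>z\<in>{1..j} \<rightarrow>\<^sub>E IA.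
    \<delta> j * A.chain_weight j z * \<gamma>B w * Q M GB (e w) (a (z 1)) * b w t * c (z j) s)"

text \<open>The difference \<open>AB - BF(A)\<close> has a separable kernel, so it vanishes exactly when its
  kernel does.\<close>

theorem intertwining_iff_kernel:
  "(\<forall>U\<in>Lp_space p M. A (B U) = B (poly_op p M \<delta> A n U)) \<longleftrightarrow>
   (AE (t, s) in M \<Otimes>\<^sub>M M.
      indicator GB s * kernel_on_GB \<delta> t s = indicator GA s * kernel_on_GA \<delta> n t s)"
proof -
  \<comment> \<open>One family of separable terms for the whole difference: the left summand of \<open>J\<close> indexes the
    terms through \<open>GB\<close>, the right summand those through \<open>GA\<close>.\<close>
  define J where "J = IB <+> (IB \<times> (SIGMA j:{1..n}. {1..j} \<rightarrow>\<^sub>E IA))"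
  define f where "f = case_sum
     (\<lambda>w t. (\<Sum>z\<in>IA. (\<gamma>A z * \<gamma>B w * Q M GA (c z) (b w)) * a z t) + (- (\<delta> 0 * \<gamma>B w)) * b w t)
     (\<lambda>(w, j, z) t. - (\<delta> j * A.chain_weight j z * \<gamma>B w * Q M GB (e w) (a (z 1))) * b w t)"
  define g where "g = case_sum (\<lambda>w s. indicator GB s * e w s)
     (\<lambda>(w :: 'j, j :: nat, z) s. indicator GA s * c (z j) s)"
  have fin: "finite {1..j}" "finite ({1..j} \<rightarrow>\<^sub>E IA)" for j :: nat
    using A.I by (auto intro: finite_PiE)
  have J: "finite J"
    unfolding J_def using A.I B.I fin by (intro finite_Plus finite_cartesian_product finite_SigmaI) auto
  have f: "f i \<in> borel_measurable M" if "i \<in> J" for i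
    using that unfolding J_def f_def
    by (auto intro!: borel_measurable_diff borel_measurable_uminus borel_measurable_sum
        borel_measurable_times Lp_fun_measurable[OF A.a] Lp_fun_measurable[OF B.a])
  have g: "g i \<in> Lp_fun q M" if "i \<in> J" for i
  proof -
    consider (Inl) w where "i = Inl w" "w \<in> IB"
      | (Inr) w j z where "i = Inr (w, j, z)" "1 \<le> j" "z \<in> {1..j} \<rightarrow>\<^sub>E IA"
      using \<open>i \<in> J\<close> unfolding J_def by auto
    then show ?thesis
    proof cases
      case Inl
      then show ?thesis
        unfolding g_def using indicator_in_Lp_fun[OF B.S B.c] by simp
    next
      case Inr
      have "z j \<in> IA" using Inr by (intro A.chain_member) auto
      then show ?thesis
        unfolding g_def Inr using indicator_in_Lp_fun[OF A.S A.c] by simp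
    qed
  qed
  have sum_J: "(\<Sum>i\<in>J. F i) = (\<Sum>w\<in>IB. F (Inl w))
      + (\<Sum>w\<in>IB. \<Sum>j=1..n. \<Sum>z\<in>{1..j} \<rightarrow>\<^sub>E IA. F (Inr (w, j, z)))" for F :: "_ \<Rightarrow> real"
  proof -
    let ?C = "SIGMA j:{1..n}. {1..j} \<rightarrow>\<^sub>E IA"
    have C: "finite ?C" by (intro finite_SigmaI fin)
    have "(\<Sum>i\<in>J. F i) = (\<Sum>w\<in>IB. F (Inl w)) + (\<Sum>y\<in>IB \<times> ?C. F (Inr y))"
      unfolding J_def sum.Plus[OF B.I finite_cartesian_product[OF B.I C]] comp_def ..
    also have "(\<Sum>y\<in>IB \<times> ?C. F (Inr y)) = (\<Sum>w\<in>IB. \<Sum>y\<in>?C. F (Inr (w, y)))"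
      by (subst sum.cartesian_product) (simp add: case_prod_unfold)
    also have "\<dots> = (\<Sum>w\<in>IB. \<Sum>j=1..n. \<Sum>z\<in>{1..j} \<rightarrow>\<^sub>E IA. F (Inr (w, j, z)))"
    proof (intro sum.cong refl)
      fix w
      show "(\<Sum>y\<in>?C. F (Inr (w, y))) = (\<Sum>j=1..n. \<Sum>z\<in>{1..j} \<rightarrow>\<^sub>E IA. F (Inr (w, j, z)))"
        using fin by (subst sum.Sigma) (simp_all add: case_prod_unfold)
    qed
    finally show ?thesis .
  qed
  \<comment> \<open>With arbitrary \<open>E\<close> and \<open>C\<close> in place of the second factors, the same rearrangement serves
    both the kernel (values at \<open>s\<close>) and the operator (pairings with \<open>x\<close>).\<close>
  have expand: "(\<Sum>i\<in>J. f i t * case_sum E (\<lambda>(w, j, z). C (z j)) i) =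
      (- (\<Sum>w\<in>IB. \<delta> 0 * \<gamma>B w * b w t * E w)
        + (\<Sum>z\<in>IA. \<Sum>w\<in>IB. \<gamma>A z * \<gamma>B w * a z t * Q M GA (c z) (b w) * E w))
      - (\<Sum>w\<in>IB. \<Sum>j=1..n. \<Sum>z\<in>{1..j} \<rightarrow>\<^sub>E IA.
          \<delta> j * A.chain_weight j z * \<gamma>B w * Q M GB (e w) (a (z 1)) * b w t * C (z j))"
    for t and E :: "'j \<Rightarrow> real" and C :: "'i \<Rightarrow> real"
  proof -
    have "f (Inl w) t * E w = - (\<delta> 0 * \<gamma>B w * b w t * E w)
        + (\<Sum>z\<in>IA. \<gamma>A z * \<gamma>B w * a z t * Q M GA (c z) (b w) * E w)" for w
      by (simp add: f_def sum_distrib_left algebra_simps)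
    moreover have "f (Inr (w, j, z)) t * C (z j)
        = - (\<delta> j * A.chain_weight j z * \<gamma>B w * Q M GB (e w) (a (z 1)) * b w t * C (z j))" for w j z
      by (simp add: f_def)
    moreover have "(\<Sum>z\<in>IA. \<Sum>w\<in>IB. \<gamma>A z * \<gamma>B w * a z t * Q M GA (c z) (b w) * E w)
        = (\<Sum>w\<in>IB. \<Sum>z\<in>IA. \<gamma>A z * \<gamma>B w * a z t * Q M GA (c z) (b w) * E w)"
      by (rule sum.swap)
    ultimately show ?thesis
      unfolding sum_J sum.case prod.case
      by (simp only: sum.distrib sum_negf diff_conv_add_uminus)
  qed
  have kernel: "(\<Sum>i\<in>J. f i t * g i s) =
      indicator GB s * kernel_on_GB \<delta> t s - indicator GA s * kernel_on_GA \<delta> n t s" for t s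
  proof -
    have "g i s = case_sum (\<lambda>w. indicator GB s * e w s) (\<lambda>(w, j, z). indicator GA s * c (z j) s) i" for i
      by (simp add: g_def split: sum.split prod.split)
    then show ?thesis
      using expand[of t "\<lambda>w. indicator GB s * e w s" "\<lambda>i. indicator GA s * c i s"]
      by (simp add: kernel_on_GB_def kernel_on_GA_def sum_distrib_left distrib_left
          right_diff_distrib mult_ac)
  qed
  have commute_iff: "A (B U) = B (poly_op p M \<delta> A n U) \<longleftrightarrow>
      (AE t in M. (\<Sum>i\<in>J. f i t * (LINT s|M. g i s * x s)) = 0)"
    if U: "U \<in> Lp_space p M" and x: "x \<in> U" for U x
  proof -
    let ?P = "poly_op p M \<delta> A n U"
    have P: "?P \<in> Lp_space p M" using U by (rule A.poly_op_in_space)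
    have BU: "B U \<in> Lp_space p M" and ABU: "A (B U) \<in> Lp_space p M" and BP: "B ?P \<in> Lp_space p M"
      using A.T B.T U P by auto
    obtain x' y x'' y' where x': "x' \<in> B U" and y: "y \<in> A (B U)" and x'': "x'' \<in> ?P" and y': "y' \<in> B ?P"
      using Lp_space_nonempty[OF P] Lp_space_nonempty[OF BU] Lp_space_nonempty[OF ABU]
        Lp_space_nonempty[OF BP] by blast
    have "AE t in M. y t = (\<Sum>z\<in>IA. \<gamma>A z * a z t * (\<Sum>w\<in>IB. \<gamma>B w * Q M GA (c z) (b w) * Q M GB (e w) x))"
      using A.apply_AE[OF BU x' y] by (simp add: B.Q_apply[OF U x x' A.S A.c] cong: sum.cong)
    moreover have "AE t in M. y' t = (\<Sum>w\<in>IB. \<gamma>B w * b w t * (\<delta> 0 * Q M GB (e w) x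
        + (\<Sum>j=1..n. \<Sum>z\<in>{1..j} \<rightarrow>\<^sub>E IA.
            \<delta> j * A.chain_weight j z * Q M GB (e w) (a (z 1)) * Q M GA (c (z j)) x)))"
      using B.apply_AE[OF P x'' y'] by (simp add: A.Q_poly_op[OF U x x'' B.S B.c] cong: sum.cong)
    ultimately have diff: "AE t in M. y t - y' t = (\<Sum>i\<in>J. f i t * (LINT s|M. g i s * x s))"
    proof eventually_elim
      case (elim t)
      have g_int: "(LINT s|M. g i s * x s)
          = case_sum (\<lambda>w. Q M GB (e w) x) (\<lambda>(w, j, z). Q M GA (c (z j)) x) i" for i
        by (simp add: g_def A.Q_as_integral split: sum.split prod.split)
      show ?case
        unfolding elim g_int expand[where E = "\<lambda>w. Q M GB (e w) x" and C = "\<lambda>i. Q M GA (c i) x"]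
        by (simp add: sum_distrib_left distrib_left sum.distrib mult_ac)
    qed
    have "(AE t in M. y t = y' t) \<longleftrightarrow> (AE t in M. (\<Sum>i\<in>J. f i t * (LINT s|M. g i s * x s)) = 0)"
      using diff by (rule eventually_cong) auto
    with Lp_space_eq_iff[OF ABU BP y y'] show ?thesis by simp
  qed
  have "(\<forall>U\<in>Lp_space p M. A (B U) = B (poly_op p M \<delta> A n U)) \<longleftrightarrow>
      (\<forall>x\<in>Lp_fun p M. AE t in M. (\<Sum>i\<in>J. f i t * (LINT s|M. g i s * x s)) = 0)"
  proof (intro iffI ballI)
    fix x assume x: "x \<in> Lp_fun p M" and "\<forall>U\<in>Lp_space p M. A (B U) = B (poly_op p M \<delta> A n U)"
    then show "AE t in M. (\<Sum>i\<in>J. f i t * (LINT s|M. g i s * x s)) = 0"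
      using commute_iff[OF Lp_class_in_space[OF x] Lp_class_self[OF x]] Lp_class_in_space[OF x] by blast
  next
    fix U assume U: "U \<in> Lp_space p M"
      and ae: "\<forall>x\<in>Lp_fun p M. AE t in M. (\<Sum>i\<in>J. f i t * (LINT s|M. g i s * x s)) = 0"
    obtain x where x: "x \<in> U" using Lp_space_nonempty[OF U] by blast
    show "A (B U) = B (poly_op p M \<delta> A n U)"
      using commute_iff[OF U x] ae Lp_space_member[OF U x] by blast
  qed
  also have "\<dots> \<longleftrightarrow> (AE (t, s) in M \<Otimes>\<^sub>M M. (\<Sum>i\<in>J. f i t * g i s) = 0)"
    by (rule A.separable_kernel_zero_iff[OF J f g])
  finally show ?thesis
    unfolding kernel by simp
qed

end

section \<open>The characterisation in terms of index triples\<close>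

lemma AE_indicator_split:
  fixes X Y R :: "'a \<Rightarrow> 'b \<Rightarrow> real"
  assumes "G = GA \<inter> GB"
  shows "(AE (t, s) in M \<Otimes>\<^sub>M N. indicator GB s * (- X t s + Y t s) = indicator GA s * R t s) \<longleftrightarrow>
    (AE (t, s) in M \<Otimes>\<^sub>M N. (t, s) \<in> space M \<times> G \<longrightarrow> - X t s + Y t s = R t s) \<and>
    (AE (t, s) in M \<Otimes>\<^sub>M N. (t, s) \<in> space M \<times> (GA - G) \<longrightarrow> R t s = 0) \<and>
    (AE (t, s) in M \<Otimes>\<^sub>M N. (t, s) \<in> space M \<times> (GB - G) \<longrightarrow> X t s = Y t s)"
  unfolding case_prod_unfold AE_conj_iff[symmetric]
  by (rule AE_cong) (auto simp: assms space_pair_measure indicator_def mem_Times_iff)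

theorem theorem1:
  fixes M :: "'a measure"
    and p q :: ennreal
    and lA1 lA2 lA3 lB1 lB2 lB3 n :: nat
    and GA GB G :: "'a set"
    and a b c e :: "nat \<Rightarrow> nat \<Rightarrow> 'a \<Rightarrow> real"
    and \<gamma>A \<gamma>B :: "nat \<Rightarrow> nat \<Rightarrow> nat \<Rightarrow> real"
    and A B :: "('a \<Rightarrow> real) set \<Rightarrow> ('a \<Rightarrow> real) set"
    and \<delta> :: "nat \<Rightarrow> real"
  assumes "sigma_finite_measure M"
    and "1 \<le> p" and "1 \<le> q" and "1 / p + 1 / q = 1"
    and "0 < lA1" and "0 < lA2" and "0 < lA3"
    and "0 < lB1" and "0 < lB2" and "0 < lB3"
    and "GA \<in> sets M" and "GB \<in> sets M"
    and "\<And>k l. k \<in> {1..lA1} \<Longrightarrow> l \<in> {1..lA3} \<Longrightarrow> a k l \<in> Lp_fun p M"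
    and "\<And>u r. u \<in> {1..lB1} \<Longrightarrow> r \<in> {1..lB3} \<Longrightarrow> b u r \<in> Lp_fun p M"
    and "\<And>i l. i \<in> {1..lA2} \<Longrightarrow> l \<in> {1..lA3} \<Longrightarrow> c i l \<in> Lp_fun q (restrict_space M GA)"
    and "\<And>w r. w \<in> {1..lB2} \<Longrightarrow> r \<in> {1..lB3} \<Longrightarrow> e w r \<in> Lp_fun q (restrict_space M GB)"
    and "A \<in> Lp_space p M \<rightarrow> Lp_space p M"
    and "B \<in> Lp_space p M \<rightarrow> Lp_space p M"
    and "\<exists>U\<in>Lp_space p M. A U \<noteq> Lp_zero p M"
    and "\<exists>U\<in>Lp_space p M. B U \<noteq> Lp_zero p M"
    and "\<And>U x y. U \<in> Lp_space p M \<Longrightarrow> x \<in> U \<Longrightarrow> y \<in> A U \<Longrightarrow>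
           AE t in M. y t = (LINT s:GA|M.
             (\<Sum>k=1..lA1. \<Sum>i=1..lA2. \<Sum>l=1..lA3. \<gamma>A k i l * a k l t * c i l s * x s))"
    and "\<And>U x y. U \<in> Lp_space p M \<Longrightarrow> x \<in> U \<Longrightarrow> y \<in> B U \<Longrightarrow>
           AE t in M. y t = (LINT s:GB|M.
             (\<Sum>u=1..lB1. \<Sum>w=1..lB2. \<Sum>r=1..lB3. \<gamma>B u w r * b u r t * e w r s * x s))"
    and "G = GA \<inter> GB"
  shows "(\<forall>U\<in>Lp_space p M. A (B U) = B (poly_op p M \<delta> A n U)) \<longleftrightarrow>
      (AE (t, s) in M \<Otimes>\<^sub>M M. (t, s) \<in> space M \<times> G \<longrightarrow>
         - (\<Sum>u=1..lB1. \<Sum>w=1..lB2. \<Sum>r=1..lB3. \<delta> 0 * \<gamma>B u w r * b u r t * e w r s)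
         + (\<Sum>k=1..lA1. \<Sum>i=1..lA2. \<Sum>l=1..lA3. \<Sum>u=1..lB1. \<Sum>w=1..lB2. \<Sum>r=1..lB3.
             \<gamma>A k i l * \<gamma>B u w r * a k l t * Q M GA (c i l) (b u r) * e w r s)
         = (\<Sum>u=1..lB1. \<Sum>w=1..lB2. \<Sum>r=1..lB3. \<Sum>j=1..n.
             \<Sum>k\<in>{1..j} \<rightarrow>\<^sub>E {1..lA1}. \<Sum>i\<in>{1..j} \<rightarrow>\<^sub>E {1..lA2}. \<Sum>l\<in>{1..j} \<rightarrow>\<^sub>E {1..lA3}.
               \<delta> j * gamma_tilde M GA a c k i l j * \<gamma>B u w r
               * (\<Prod>v=1..j. \<gamma>A (k v) (i v) (l v))
               * Q M GB (e w r) (a (k 1) (l 1)) * b u r t * c (i j) (l j) s)) \<and>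
      (AE (t, s) in M \<Otimes>\<^sub>M M. (t, s) \<in> space M \<times> (GA - G) \<longrightarrow>
         (\<Sum>u=1..lB1. \<Sum>w=1..lB2. \<Sum>r=1..lB3. \<Sum>j=1..n.
             \<Sum>k\<in>{1..j} \<rightarrow>\<^sub>E {1..lA1}. \<Sum>i\<in>{1..j} \<rightarrow>\<^sub>E {1..lA2}. \<Sum>l\<in>{1..j} \<rightarrow>\<^sub>E {1..lA3}.
               \<delta> j * gamma_tilde M GA a c k i l j * \<gamma>B u w r
               * (\<Prod>v=1..j. \<gamma>A (k v) (i v) (l v))
               * Q M GB (e w r) (a (k 1) (l 1)) * b u r t * c (i j) (l j) s)
         = 0) \<and>
      (AE (t, s) in M \<Otimes>\<^sub>M M. (t, s) \<in> space M \<times> (GB - G) \<longrightarrow>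
         (\<Sum>u=1..lB1. \<Sum>w=1..lB2. \<Sum>r=1..lB3. \<delta> 0 * \<gamma>B u w r * b u r t * e w r s)
         = (\<Sum>k=1..lA1. \<Sum>i=1..lA2. \<Sum>l=1..lA3. \<Sum>u=1..lB1. \<Sum>w=1..lB2. \<Sum>r=1..lB3.
             \<gamma>A k i l * \<gamma>B u w r * a k l t * Q M GA (c i l) (b u r) * e w r s))"
proof -
  interpret conjugate_exponents M p q
    using assms(1-4) by (intro conjugate_exponents.intro conjugate_exponents_axioms.intro)
  \<comment> \<open>A triple \<open>(k, i, l)\<close> labels one summand; each of \<open>a\<close>, \<open>c\<close>, \<open>b\<close> and \<open>e\<close> ignores the component it does not carry.\<close>
  define IA IB where "IA = {1..lA1} \<times> {1..lA2} \<times> {1..lA3}" and "IB = {1..lB1} \<times> {1..lB2} \<times> {1..lB3}"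
  define \<gamma>A' a' c' where "\<gamma>A' = (\<lambda>(k, i, l). \<gamma>A k i l)" and "a' = (\<lambda>(k :: nat, i :: nat, l). a k l)"
    and "c' = (\<lambda>(k :: nat, i, l). c i l)"
  define \<gamma>B' b' e' where "\<gamma>B' = (\<lambda>(u, w, r). \<gamma>B u w r)" and "b' = (\<lambda>(u, w :: nat, r). b u r)"
    and "e' = (\<lambda>(u :: nat, w, r). e w r)"
  have c': "c' z \<in> Lp_fun q (restrict_space M GA)" if "z \<in> IA" for z
    using that assms(15) by (auto simp: IA_def c'_def)
  have e': "e' z \<in> Lp_fun q (restrict_space M GB)" if "z \<in> IB" for z
    using that assms(16) by (auto simp: IB_def e'_def)
  interpret finite_rank_operator_pair M p q GA IA \<gamma>A' a' c' A GB IB \<gamma>B' b' e' B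
  proof (unfold_locales)
    show "GA \<in> sets M" "GB \<in> sets M" "A \<in> Lp_space p M \<rightarrow> Lp_space p M" "B \<in> Lp_space p M \<rightarrow> Lp_space p M"
      by fact+
    show "finite IA" "finite IB" by (simp_all add: IA_def IB_def)
    show "a' z \<in> Lp_fun p M" if "z \<in> IA" for z
      using that assms(13) by (auto simp: IA_def a'_def)
    show "b' z \<in> Lp_fun p M" if "z \<in> IB" for z
      using that assms(14) by (auto simp: IB_def b'_def)
    show "c' z \<in> Lp_fun q (restrict_space M GA)" if "z \<in> IA" for z by (rule c'[OF that])
    show "e' z \<in> Lp_fun q (restrict_space M GB)" if "z \<in> IB" for z by (rule e'[OF that])
    show "AE t in M. y t = (\<Sum>z\<in>IA. \<gamma>A' z * a' z t * Q M GA (c' z) x)"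
      if "U \<in> Lp_space p M" "x \<in> U" "y \<in> A U" for U x y
    proof -
      have "(LINT s:GA|M. (\<Sum>k=1..lA1. \<Sum>i=1..lA2. \<Sum>l=1..lA3. \<gamma>A k i l * a k l t * c i l s * x s))
          = (LINT s:GA|M. (\<Sum>z\<in>IA. \<gamma>A' z * a' z t * c' z s * x s))" for t
        by (simp add: IA_def sum_triples \<gamma>A'_def a'_def c'_def)
      also have "\<dots> t = (\<Sum>z\<in>IA. \<gamma>A' z * a' z t * Q M GA (c' z) x)" for t
        by (rule integral_finite_rank_kernel[OF assms(11) c' Lp_space_member[OF that(1,2)]])
      finally show ?thesis using assms(21)[OF that] by simp
    qed
    show "AE t in M. y t = (\<Sum>z\<in>IB. \<gamma>B' z * b' z t * Q M GB (e' z) x)"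
      if "U \<in> Lp_space p M" "x \<in> U" "y \<in> B U" for U x y
    proof -
      have "(LINT s:GB|M. (\<Sum>u=1..lB1. \<Sum>w=1..lB2. \<Sum>r=1..lB3. \<gamma>B u w r * b u r t * e w r s * x s))
          = (LINT s:GB|M. (\<Sum>z\<in>IB. \<gamma>B' z * b' z t * e' z s * x s))" for t
        by (simp add: IB_def sum_triples \<gamma>B'_def b'_def e'_def)
      also have "\<dots> t = (\<Sum>z\<in>IB. \<gamma>B' z * b' z t * Q M GB (e' z) x)" for t
        by (rule integral_finite_rank_kernel[OF assms(12) e' Lp_space_member[OF that(1,2)]])
      finally show ?thesis using assms(22)[OF that] by simp
    qed
  qed
  have commutator: "kernel_on_GB \<delta> t s =
      - (\<Sum>u=1..lB1. \<Sum>w=1..lB2. \<Sum>r=1..lB3. \<delta> 0 * \<gamma>B u w r * b u r t * e w r s)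
      + (\<Sum>k=1..lA1. \<Sum>i=1..lA2. \<Sum>l=1..lA3. \<Sum>u=1..lB1. \<Sum>w=1..lB2. \<Sum>r=1..lB3.
          \<gamma>A k i l * \<gamma>B u w r * a k l t * Q M GA (c i l) (b u r) * e w r s)" for t s
    unfolding kernel_on_GB_def unfolding IA_def IB_def sum_triples
    by (simp only: \<gamma>A'_def a'_def c'_def \<gamma>B'_def b'_def e'_def prod.case)
  have weight: "A.chain_weight j (\<lambda>v\<in>{1..j}. (k v, i v, l v))
      = gamma_tilde M GA a c k i l j * (\<Prod>v=1..j. \<gamma>A (k v) (i v) (l v))" for j k i l
    unfolding A.chain_weight_def unfolding gamma_tilde_def \<gamma>A'_def a'_def c'_def
    by (intro arg_cong2[of _ _ _ _ "(*)"] prod.cong) auto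
  have power: "kernel_on_GA \<delta> n t s = (\<Sum>u=1..lB1. \<Sum>w=1..lB2. \<Sum>r=1..lB3. \<Sum>j=1..n.
      \<Sum>k\<in>{1..j} \<rightarrow>\<^sub>E {1..lA1}. \<Sum>i\<in>{1..j} \<rightarrow>\<^sub>E {1..lA2}. \<Sum>l\<in>{1..j} \<rightarrow>\<^sub>E {1..lA3}.
        \<delta> j * gamma_tilde M GA a c k i l j * \<gamma>B u w r
        * (\<Prod>v=1..j. \<gamma>A (k v) (i v) (l v))
        * Q M GB (e w r) (a (k 1) (l 1)) * b u r t * c (i j) (l j) s)" for t s
    unfolding kernel_on_GA_def unfolding IA_def IB_def sum_triples sum_PiE_triples weight
  proof (intro sum.cong refl)
    fix u w r j k i l
    assume "j \<in> {1..n}"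
    then have "1 \<in> {1..j}" "j \<in> {1..j}" by auto
    then show "\<delta> j * (gamma_tilde M GA a c k i l j * (\<Prod>v=1..j. \<gamma>A (k v) (i v) (l v))) * \<gamma>B' (u, w, r)
        * Q M GB (e' (u, w, r)) (a' ((\<lambda>v\<in>{1..j}. (k v, i v, l v)) 1)) * b' (u, w, r) t
        * c' ((\<lambda>v\<in>{1..j}. (k v, i v, l v)) j) s
      = \<delta> j * gamma_tilde M GA a c k i l j * \<gamma>B u w r * (\<Prod>v=1..j. \<gamma>A (k v) (i v) (l v))
        * Q M GB (e w r) (a (k 1) (l 1)) * b u r t * c (i j) (l j) s"
      by (simp only: restrict_apply' a'_def c'_def \<gamma>B'_def b'_def e'_def prod.case mult_ac)
  qed
  show ?thesis
    unfolding intertwining_iff_kernel commutator power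
    by (rule AE_indicator_split) fact
qed

end
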